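(* Let $f:\mathbb{R}^d\to\mathbb{R}$ be differentiable and convex and admit a minimizer; let $x^\star$ be a minimizer and $f^\star:=f(x^\star)$. Suppose $f$ is matrix smooth with matrix $\mathbb{L}$ (as in the context), $L:=\|\mathbb{L}\|$, and suppose the random matrix $P\in\mathbb{R}^{d\times r}$ satisfies the sketch moment conditions (as in the context) with constants $\omega,\ell>0$. Let $\{x_k,y_k,z_k\}$ be generated by algorithm RS-NAG-C (as in the context) from $x_0\in\mathbb{R}^d$ with sketches $\{P_k\}_{k\ge 0}$ that are i.i.d. copies of $P$. Then, for all $N\ge 1$, $$\mathbb{E}[f(x_N)-f^\star]\le 2L\omega\ell\,\frac{\|x_0-x^\star\|^2}{N^2}.$$ In particular, with $R_0:=\|x_0-x^\star\|$, the iteration complexity to guarantee $\mathbb{E}[f(x_N)-f^\star]\le\epsilon$ is $N=\mathcal{O}\big(R_0\sqrt{L\omega\ell/\epsilon}\big)$, and, since one iteration uses $r$ oracle calls, the oracle complexity is $rN=\mathcal{O}\big(R_0\sqrt{L\omega\ell r^2/\epsilon}\big)$; that is, there is an absolute constant $C>0$ such that for every $\epsilon>0$ and every integer $N\ge1$ with $N\ge C R_0\sqrt{L\omega\ell/\epsilon}$ (equivalently, with number of oracle calls $rN\ge C R_0\sqrt{L\omega\ell r^2/\epsilon}$) one has $\mathbb{E}[f(x_N)-f^\star]\le\epsilon$.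
   Context: Standing assumptions: $d\ge2$, $1\le r\le d$. $\|\cdot\|$ is the Euclidean norm for vectors and the induced operator norm for matrices; $A\preceq B$ means $B-A$ is positive semidefinite. Matrix smoothness: there is a fixed symmetric matrix $\mathbb{L}\in\mathbb{R}^{d\times d}$, $\mathbb{L}\succeq0$, $\mathbb{L}\ne0$, such that for all $x,y\in\mathbb{R}^d$, $f(y)\le f(x)+\langle\nabla f(x),y-x\rangle+\tfrac12(y-x)^\top\mathbb{L}(y-x)$. Put $L:=\|\mathbb{L}\|$. Sketch moment conditions: $P\in\mathbb{R}^{d\times r}$ is a random matrix (the expectations below being finite) and $\omega>0,\ell>0$ are constants with $\mathbb{E}[PP^\top]=I_d$, $\mathbb{E}[(PP^\top)^2]\preceq\omega I_d$, $\mathbb{E}[PP^\top\mathbb{L}PP^\top]\preceq\ell L\,I_d$. Algorithm RS-NAG-C: given deterministic $x_0\in\mathbb{R}^d$ and i.i.d. copies $P_k$ of $P$, set $m=1/(2L\ell)$, $A_0=0$, $z_0=x_0$, and for $k=0,1,2,\dots$: $a_{k+1}=\dfrac{m+\sqrt{m^2+2\omega mA_k}}{\omega}$, $A_{k+1}=A_k+a_{k+1}$, $y_k=\dfrac{A_k}{A_{k+1}}x_k+\dfrac{a_{k+1}}{A_{k+1}}z_k$, $x_{k+1}=y_k-\dfrac1{L\ell}P_kP_k^\top\nabla f(y_k)$, $z_{k+1}=z_k-a_{k+1}P_kP_k^\top\nabla f(y_k)$. Oracle model: one oracle call is one directional-derivative evaluation; evaluating $P_k^\top\nabla f(y_k)$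 costs $r$ calls, so $N$ iterations cost $rN$ calls. *)

theory Defs
  imports "HOL-Probability.Probability"
begin

definition gradient :: "('v::real_inner \<Rightarrow> real) \<Rightarrow> 'v \<Rightarrow> 'v" where
  "gradient f x = (THE g. GDERIV f x :> g)"

definition op_norm :: "real^'n^'m \<Rightarrow> real" where
  "op_norm A = onorm (\<lambda>v. A *v v)"

definition psd :: "real^'n^'n \<Rightarrow> bool" where
  "psd A \<longleftrightarrow> transpose A = A \<and> (\<forall>v. 0 \<le> v \<bullet> (A *v v))"

definition loewner_le :: "real^'n^'n \<Rightarrow> real^'n^'n \<Rightarrow> bool" (infix "\<preceq>\<^sub>L" 50) where
  "A \<preceq>\<^sub>L B \<longleftrightarrow> psd (B - A)"

definition matrix_smooth :: "(real^'d \<Rightarrow> real) \<Rightarrow> real^'d^'d \<Rightarrow> bool" where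
  "matrix_smooth f LL \<longleftrightarrow> psd LL \<and> LL \<noteq> 0 \<and>
     (\<forall>x y. f y \<le> f x + gradient f x \<bullet> (y - x) + 1/2 * ((y - x) \<bullet> (LL *v (y - x))))"

definition gram :: "real^'r^'d \<Rightarrow> real^'d^'d" where
  "gram P = P ** transpose P"

text \<open>The expectations are Bochner integrals of matrix-valued functions. Since a Bochner integral
  is 0 for a non-integrable function, finiteness of each expectation is stated separately.\<close>

definition sketch_moments ::
    "'b measure \<Rightarrow> ('b \<Rightarrow> real^'r^'d) \<Rightarrow> real^'d^'d \<Rightarrow> real \<Rightarrow> real \<Rightarrow> bool" where
  "sketch_moments M P LL w l \<longleftrightarrow>
     integrable M (\<lambda>s. gram (P s)) \<and>
     integrable M (\<lambda>s. gram (P s) ** gram (P s)) \<and>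
     integrable M (\<lambda>s. gram (P s) ** LL ** gram (P s)) \<and>
     (\<integral>s. gram (P s) \<partial>M) = mat 1 \<and>
     (\<integral>s. gram (P s) ** gram (P s) \<partial>M) \<preceq>\<^sub>L w *\<^sub>R mat 1 \<and>
     (\<integral>s. gram (P s) ** LL ** gram (P s) \<partial>M) \<preceq>\<^sub>L (l * op_norm LL) *\<^sub>R mat 1"

definition iid_copies :: "'a measure \<Rightarrow> (nat \<Rightarrow> 'a \<Rightarrow> 'c::topological_space) \<Rightarrow> 'b measure \<Rightarrow> ('b \<Rightarrow> 'c) \<Rightarrow> bool" where
  "iid_copies M Ps M0 P \<longleftrightarrow>
     prob_space.indep_vars M (\<lambda>_. borel) Ps UNIV \<and>
     (\<forall>k. distr M borel (Ps k) = distr M0 borel P)"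

text \<open>One realisation of RS-NAG-C, for a fixed sequence of matrices \<open>Ps\<close>; \<open>L\<close> is the scalar
  smoothness constant. The weight \<open>a 0\<close> is never used and is left unconstrained.\<close>

definition rs_nag_c_run ::
    "(real^'d \<Rightarrow> real) \<Rightarrow> real \<Rightarrow> real \<Rightarrow> real \<Rightarrow> real^'d \<Rightarrow> (nat \<Rightarrow> real^'r^'d) \<Rightarrow>
     (nat \<Rightarrow> real) \<Rightarrow> (nat \<Rightarrow> real) \<Rightarrow>
     (nat \<Rightarrow> real^'d) \<Rightarrow> (nat \<Rightarrow> real^'d) \<Rightarrow> (nat \<Rightarrow> real^'d) \<Rightarrow> bool" where
  "rs_nag_c_run f L w l x0 Ps a A x y z \<longleftrightarrow>
     (let m = 1 / (2 * L * l) in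
       A 0 = 0 \<and> x 0 = x0 \<and> z 0 = x0 \<and>
       (\<forall>k. a (Suc k) = (m + sqrt (m\<^sup>2 + 2 * w * m * A k)) / w \<and>
            A (Suc k) = A k + a (Suc k) \<and>
            y k = (A k / A (Suc k)) *\<^sub>R x k + (a (Suc k) / A (Suc k)) *\<^sub>R z k \<and>
            x (Suc k) = y k - (1 / (L * l)) *\<^sub>R (Ps k *v (transpose (Ps k) *v gradient f (y k))) \<and>
            z (Suc k) = z k - a (Suc k) *\<^sub>R (Ps k *v (transpose (Ps k) *v gradient f (y k)))))"

text \<open>Iteration \<open>k\<close> evaluates the \<open>r\<close> entries of \<open>transpose (Ps k) *v gradient f (y k)\<close>, which are the
  directional derivatives of \<open>f\<close> at \<open>y k\<close> along the \<open>r\<close> columns of \<open>Ps k\<close>; each is one oracle call.\<close>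

definition oracle_calls :: "nat \<Rightarrow> nat \<Rightarrow> nat" where
  "oracle_calls r N = (\<Sum>k<N. r)"

text \<open>The absolute constant of the complexity bounds. The dimensions and the sample spaces are types,
  so an existential quantifier inside a theorem would allow the constant to depend on them. A closed
  term of type \<^typ>\<open>real\<close> cannot. The value \<open>sqrt 2\<close> is read off from the rate \<open>2 L w l R\<^sup>2 / N\<^sup>2\<close>.\<close>

definition complexity_const :: real where
  "complexity_const = sqrt 2"

end

theory Submission
  imports Defs
begin

text \<open>The potential \<open>A k * (f (x k) - f xstar) + 1/2 * norm (z k - xstar)\<^sup>2\<close> is a
  supermartingale: conditionally on the past, the moment conditions turn matrix smoothness into an
  expected decrease of \<open>m * norm (gradient f (y k))\<^sup>2\<close> in the \<open>x\<close>-step, and the weights solve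
  \<open>w * (a (Suc k))\<^sup>2 = 2 * m * A (Suc k)\<close>, so that this decrease cancels the second-moment term of the
  \<open>z\<close>-step. Since the potential is nonnegative, all expectations can be taken as nonnegative
  integrals over the product of the law of the past and the law of the current sketch, and
  integrability comes out at the end. The rate follows from \<open>A N \<ge> m * N\<^sup>2 / (2 * w)\<close>.\<close>

section \<open>Gradients\<close>

text \<open>The definite description in \<open>gradient\<close> is legitimate: the coordinates
  \<open>D i\<close> of a derivative \<open>D\<close> assemble into a representing vector, and
  uniqueness of the Frechet derivative makes that vector unique.\<close>

lemma GDERIV_gradient:
  fixes f :: "'v::euclidean_space \<Rightarrow> real"
  assumes "f differentiable (at x)"
  shows "GDERIV f x :> gradient f x"
proof -
  from assms obtain D where D: "(f has_derivative D) (at x)"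
    by (auto simp: differentiable_def)
  then have lin: "linear D"
    by (rule has_derivative_linear)
  define g where "g = (\<Sum>i\<in>Basis. D i *\<^sub>R i)"
  have "D h = h \<bullet> g" for h
  proof -
    have "D h = D (\<Sum>i\<in>Basis. (h \<bullet> i) *\<^sub>R i)"
      by (simp add: euclidean_representation)
    also have "\<dots> = h \<bullet> g"
      by (simp add: g_def linear_sum[OF lin] linear_scale[OF lin] inner_sum_right mult.commute)
    finally show ?thesis .
  qed
  then have "D = (\<lambda>h. h \<bullet> g)"
    by (rule ext)
  with D have g: "GDERIV f x :> g"
    by (simp add: gderiv_def)
  have "g' = g" if "GDERIV f x :> g'" for g'
  proof -
    have "(\<lambda>h. h \<bullet> g') = (\<lambda>h. h \<bullet> g)"
      using that g unfolding gderiv_def by (rule has_derivative_unique)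
    then show ?thesis
      unfolding fun_eq_iff by (simp only: vector_eq_ldot)
  qed
  with g show ?thesis
    unfolding gradient_def by (rule theI)
qed

text \<open>Chain rule along a line. It serves both the convexity inequality and the measurability
  of the gradient.\<close>

lemma GDERIV_line:
  assumes "GDERIV f x :> g"
  shows "((\<lambda>t::real. f (x + t *\<^sub>R v)) has_field_derivative g \<bullet> v) (at 0)"
proof -
  have "(f has_derivative (\<lambda>h. h \<bullet> g)) (at (x + 0 *\<^sub>R v))"
    using assms by (simp add: gderiv_def)
  moreover have "((\<lambda>t. x + t *\<^sub>R v) has_derivative (\<lambda>t. t *\<^sub>R v)) (at 0)"
    by (auto intro!: derivative_eq_intros)
  ultimately have "((\<lambda>t. f (x + t *\<^sub>R v)) has_derivative (\<lambda>t. (t *\<^sub>R v) \<bullet> g)) (at 0)"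
    by (rule has_derivative_compose[rotated])
  then show ?thesis
    by (simp add: has_field_derivative_def inner_commute mult_commute_abs)
qed

text \<open>On the line from \<open>x\<close> to \<open>u\<close> the function is convex in one real
  variable; its tangent at parameter 0, evaluated at parameter 1, gives the bound.\<close>

lemma convex_on_above_gradient:
  fixes f :: "'v::real_inner \<Rightarrow> real"
  assumes "convex_on UNIV f" and "GDERIV f x :> g"
  shows "f x + g \<bullet> (u - x) \<le> f u"
proof -
  let ?\<phi> = "\<lambda>t::real. f (x + t *\<^sub>R (u - x))"
  have "convex_on UNIV ?\<phi>"
  proof (rule convex_onI)
    fix t p q :: real
    assume "0 < t" "t < 1"
    moreover have "x + ((1 - t) *\<^sub>R p + t *\<^sub>R q) *\<^sub>R (u - x)
        = (1 - t) *\<^sub>R (x + p *\<^sub>R (u - x)) + t *\<^sub>R (x + q *\<^sub>R (u - x))"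
      by (simp add: algebra_simps)
    ultimately show "?\<phi> ((1 - t) *\<^sub>R p + t *\<^sub>R q) \<le> (1 - t) * ?\<phi> p + t * ?\<phi> q"
      using convex_onD[OF assms(1), of t "x + p *\<^sub>R (u - x)" "x + q *\<^sub>R (u - x)"] by simp
  qed simp
  then have "?\<phi> 1 - ?\<phi> 0 \<ge> (g \<bullet> (u - x)) * (1 - 0)"
    using GDERIV_line[OF assms(2), of "u - x"]
    by (intro convex_on_imp_above_tangent[where A = UNIV]) auto
  then show ?thesis
    by simp
qed

text \<open>Without any appeal to continuity of the gradient: each of its components is a pointwise
  limit of difference quotients of \<open>f\<close>, which is continuous.\<close>

lemma borel_measurable_gradient:
  fixes f :: "'v::euclidean_space \<Rightarrow> real"
  assumes "\<And>x. f differentiable (at x)"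
  shows "gradient f \<in> borel_measurable borel"
proof -
  have [measurable]: "f \<in> borel_measurable borel"
    using assms
    by (intro borel_measurable_continuous_onI continuous_at_imp_continuous_on ballI
        differentiable_imp_continuous_within)
  have "(\<lambda>x. gradient f x \<bullet> i) \<in> borel_measurable borel" for i
  proof (rule borel_measurable_LIMSEQ_real)
    show "(\<lambda>n. (f (x + inverse (real (Suc n)) *\<^sub>R i) - f x) / inverse (real (Suc n)))
        \<longlonglongrightarrow> gradient f x \<bullet> i" for x
    proof -
      have "(\<lambda>h. (f (x + h *\<^sub>R i) - f x) / h) \<midarrow>0\<rightarrow> gradient f x \<bullet> i"
        using GDERIV_line[OF GDERIV_gradient[OF assms], of x i] by (simp add: DERIV_def)
      \<comment> \<open>The increments tend to 0 and never equal 0, so the punctured limit of the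
        quotients can be taken along them.\<close>
      moreover have "filterlim (\<lambda>n. inverse (real (Suc n))) (at 0) sequentially"
        unfolding filterlim_at using LIMSEQ_inverse_real_of_nat by simp
      ultimately show ?thesis
        by (rule filterlim_compose)
    qed
  qed measurable
  then show ?thesis
    by (rule borel_measurable_euclidean_space[THEN iffD2, OF ballI])
qed

section \<open>Supermartingale property of a random recursion\<close>

text \<open>The noise is an explicit sequence rather than a random variable, so that dependence on
  finitely many coordinates can be stated.\<close>

primrec orbit :: "(nat \<Rightarrow> 's \<Rightarrow> 'e \<Rightarrow> 's) \<Rightarrow> 's \<Rightarrow> nat \<Rightarrow> (nat \<Rightarrow> 'e) \<Rightarrow> 's" where
  "orbit F u 0 \<omega> = u"
| "orbit F u (Suc k) \<omega> = F k (orbit F u k \<omega>) (\<omega> k)"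

text \<open>The state at time \<open>k\<close> reads only the coordinates strictly below
  \<open>k\<close>; this is why it is independent of the noise at \<open>k\<close>.\<close>

lemma orbit_cong:
  assumes "\<And>i. i < k \<Longrightarrow> \<omega> i = \<omega>' i"
  shows "orbit F u k \<omega> = orbit F u k \<omega>'"
  using assms by (induction k) auto

text \<open>The index set \<open>J\<close> may be larger than \<open>{..<k}\<close>, so that the
  induction stays on one product space although the number of coordinates read grows.\<close>

lemma measurable_orbit:
  assumes F: "\<And>k. case_prod (F k) \<in> measurable (S \<Otimes>\<^sub>M E) S" and "u \<in> space S" and "{..<k} \<subseteq> J"
  shows "orbit F u k \<in> measurable (PiM J (\<lambda>_. E)) S"
  using assms(3)
proof (induction k)
  case 0
  have "orbit F u 0 = (\<lambda>_. u)"
    by (rule ext) simp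
  then show ?case
    using \<open>u \<in> space S\<close> by simp
next
  case (Suc k)
  then have J: "{..<k} \<subseteq> J" "k \<in> J"
    by auto
  have pair: "(\<lambda>\<omega>. (orbit F u k \<omega>, \<omega> k)) \<in> measurable (PiM J (\<lambda>_. E)) (S \<Otimes>\<^sub>M E)"
    using Suc.IH[OF J(1)] measurable_component_singleton[OF J(2)] by (rule measurable_Pair)
  have eq: "orbit F u (Suc k) = (\<lambda>\<omega>. case_prod (F k) (orbit F u k \<omega>, \<omega> k))"
    by (rule ext) simp
  show ?case
    unfolding eq using pair F by (rule measurable_compose)
qed

text \<open>The state at \<open>k\<close> is a function of the earlier noise, so its past and the
  current noise have a product joint law. Tonelli integrates out the current noise with the state
  frozen at \<open>v\<close>, where \<open>step\<close> applies. This replaces conditional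
  expectations.\<close>

lemma (in prob_space) nn_integral_orbit_le:
  fixes \<xi> :: "nat \<Rightarrow> 'a \<Rightarrow> 'e" and V :: "nat \<Rightarrow> 's \<Rightarrow> ennreal"
  assumes indep: "indep_vars (\<lambda>_. E) \<xi> UNIV"
    and law: "\<And>k. distr M E (\<xi> k) = \<mu>"
    and F: "\<And>k. case_prod (F k) \<in> measurable (S \<Otimes>\<^sub>M E) S"
    and u: "u \<in> space S"
    and V: "\<And>k. V k \<in> borel_measurable S"
    and X0: "\<And>s. s \<in> space M \<Longrightarrow> X 0 s = u"
    and XSuc: "\<And>k s. s \<in> space M \<Longrightarrow> X (Suc k) s = F k (X k s) (\<xi> k s)"
    and step: "\<And>k v. v \<in> space S \<Longrightarrow> (\<integral>\<^sup>+ p. V (Suc k) (F k v p) \<partial>\<mu>) \<le> V k v"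
  shows "X k \<in> measurable M S" and "(\<integral>\<^sup>+ s. V k (X k s) \<partial>M) \<le> V 0 u"
proof -
  have \<xi>[measurable]: "\<xi> k \<in> measurable M E" for k
    using indep by (auto simp: indep_vars_def)
  have X: "X k s = orbit F u k (\<lambda>i. \<xi> i s)" if "s \<in> space M" for k s
    using that by (induction k) (simp_all add: X0 XSuc)
  have Xr: "X k s = orbit F u k (restrict (\<lambda>i. \<xi> i s) {..<k})" if "s \<in> space M" for k s
    unfolding X[OF that] by (rule orbit_cong) simp
  \<comment> \<open>\<open>indep_var\<close> relates variables of one type only, so the current noise is also represented as
    a function on indices.\<close>
  define past where "past k s = restrict (\<lambda>i. \<xi> i s) {..<k}" for k s
  define now where "now k s = restrict (\<lambda>i. \<xi> i s) {k}" for k s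
  have X_past: "X k s = orbit F u k (past k s)" if "s \<in> space M" for k s
    using Xr[OF that] by (simp add: past_def)
  have past[measurable]: "past k \<in> measurable M (PiM {..<k} (\<lambda>_. E))" for k
    unfolding past_def by (intro measurable_restrict) simp
  have now[measurable]: "now k \<in> measurable M (PiM {k} (\<lambda>_. E))" for k
    unfolding now_def by (intro measurable_restrict) simp
  have orbit[measurable]: "orbit F u k \<in> measurable (PiM {..<k} (\<lambda>_. E)) S" for k
    by (rule measurable_orbit[OF F u order_refl])
  have "(\<lambda>s. orbit F u k (past k s)) \<in> measurable M S" for k
    by measurable
  then show meas: "X k \<in> measurable M S" for k
    by (simp add: X_past cong: measurable_cong)
  have indep_past: "distr M (PiM {..<k} (\<lambda>_. E) \<Otimes>\<^sub>M PiM {k} (\<lambda>_. E)) (\<lambda>s. (past k s, now k s))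
      = distr M (PiM {..<k} (\<lambda>_. E)) (past k) \<Otimes>\<^sub>M distr M (PiM {k} (\<lambda>_. E)) (now k)" for k
  proof -
    have "indep_var (PiM {..<k} (\<lambda>_. E)) (past k) (PiM {k} (\<lambda>_. E)) (now k)"
      unfolding past_def now_def by (rule indep_var_restrict[OF indep]) auto
    then show ?thesis
      by (simp add: indep_var_distribution_eq)
  qed
  show "(\<integral>\<^sup>+ s. V k (X k s) \<partial>M) \<le> V 0 u"
  proof (induction k)
    case 0
    have "(\<integral>\<^sup>+ s. V 0 (X 0 s) \<partial>M) = (\<integral>\<^sup>+ s. V 0 u \<partial>M)"
      by (intro nn_integral_cong) (simp add: X0)
    then show ?case
      by (simp add: emeasure_space_1)
  next
    case (Suc k)
    let ?A = "PiM {..<k} (\<lambda>_. E)" and ?B = "PiM {k} (\<lambda>_. E)"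
    \<comment> \<open>Provides the sigma-finiteness that Tonelli needs below.\<close>
    interpret now: prob_space "distr M ?B (now k)"
      by (rule prob_space_distr) simp
    define W where "W v p = V (Suc k) (F k v p)" for v p
    have W: "case_prod W \<in> borel_measurable (S \<Otimes>\<^sub>M E)"
      using measurable_compose[OF F V] by (simp add: W_def case_prod_unfold)
    have "(\<lambda>(\<omega>, \<omega>'). (orbit F u k \<omega>, \<omega>' k)) \<in> measurable (?A \<Otimes>\<^sub>M ?B) (S \<Otimes>\<^sub>M E)"
      by measurable
    from measurable_compose[OF this W]
    have Wo: "(\<lambda>(\<omega>, \<omega>'). W (orbit F u k \<omega>) (\<omega>' k)) \<in> borel_measurable (?A \<Otimes>\<^sub>M ?B)"
      by (simp add: case_prod_unfold)
    \<comment> \<open>The law on the one-point product is pulled back to \<open>M\<close> and pushed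
      forward along \<open>\<xi> k\<close>, which turns it into \<open>\<mu>\<close>.\<close>
    have inner: "(\<integral>\<^sup>+ \<omega>'. W v (\<omega>' k) \<partial>distr M ?B (now k)) \<le> V k v" if v: "v \<in> space S" for v
    proof -
      have Wv: "W v \<in> borel_measurable E"
        using measurable_compose[OF measurable_Pair1'[OF v] W] by simp
      have "(\<integral>\<^sup>+ \<omega>'. W v (\<omega>' k) \<partial>distr M ?B (now k)) = (\<integral>\<^sup>+ s. W v (now k s k) \<partial>M)"
        by (rule nn_integral_distr[OF now])
           (use measurable_compose[OF measurable_component_singleton[of k "{k}"] Wv] in simp)
      also have "\<dots> = (\<integral>\<^sup>+ s. W v (\<xi> k s) \<partial>M)"
        by (simp add: now_def)
      also have "\<dots> = (\<integral>\<^sup>+ p. W v p \<partial>distr M E (\<xi> k))"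
        by (rule nn_integral_distr[OF \<xi>, symmetric]) (use Wv in simp)
      also have "\<dots> \<le> V k v"
        using step[OF v] by (simp add: law W_def)
      finally show ?thesis .
    qed
    have "(\<integral>\<^sup>+ s. V (Suc k) (X (Suc k) s) \<partial>M)
        = (\<integral>\<^sup>+ s. (\<lambda>(\<omega>, \<omega>'). W (orbit F u k \<omega>) (\<omega>' k)) (past k s, now k s) \<partial>M)"
    proof (rule nn_integral_cong)
      fix s
      assume s: "s \<in> space M"
      show "V (Suc k) (X (Suc k) s) = (\<lambda>(\<omega>, \<omega>'). W (orbit F u k \<omega>) (\<omega>' k)) (past k s, now k s)"
        unfolding XSuc[OF s] by (simp add: W_def now_def X_past[OF s])
    qed
    also have "\<dots> = (\<integral>\<^sup>+ q. (case q of (\<omega>, \<omega>') \<Rightarrow> W (orbit F u k \<omega>) (\<omega>' k))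
        \<partial>distr M (?A \<Otimes>\<^sub>M ?B) (\<lambda>s. (past k s, now k s)))"
      by (rule nn_integral_distr[symmetric]) (use Wo in simp_all)
    also have "\<dots> = (\<integral>\<^sup>+ \<omega>. \<integral>\<^sup>+ \<omega>'. W (orbit F u k \<omega>) (\<omega>' k) \<partial>distr M ?B (now k) \<partial>distr M ?A (past k))"
      unfolding indep_past
      by (subst now.nn_integral_fst[symmetric])
         (use Wo in \<open>simp_all cong: measurable_cong_sets sets_pair_measure_cong\<close>)
    also have "\<dots> \<le> (\<integral>\<^sup>+ \<omega>. V k (orbit F u k \<omega>) \<partial>distr M ?A (past k))"
      by (rule nn_integral_mono) (use measurable_space[OF orbit] in \<open>simp add: inner\<close>)
    also have "\<dots> = (\<integral>\<^sup>+ s. V k (orbit F u k (past k s)) \<partial>M)"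
      by (rule nn_integral_distr[OF past]) (use measurable_compose[OF orbit V] in simp)
    also have "\<dots> = (\<integral>\<^sup>+ s. V k (X k s) \<partial>M)"
      by (intro nn_integral_cong) (simp add: X_past)
    also note Suc.IH
    finally show ?case .
  qed
qed

section \<open>Moments of the sketch\<close>

text \<open>Lets bilinear forms in fixed vectors commute with the Bochner integral of a random
  matrix.\<close>

lemma bounded_linear_inner_matrix_vector:
  "bounded_linear (\<lambda>Q::real^'n^'m. u \<bullet> (Q *v v))"
  by (rule linear_conv_bounded_linear[THEN iffD1], rule linearI)
     (simp_all add: matrix_vector_mult_add_rdistrib inner_add_right
        flip: scaleR_matrix_vector_assoc)

lemma loewner_le_scaleR_mat_1_D:
  assumes "Q \<preceq>\<^sub>L c *\<^sub>R mat 1"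
  shows "v \<bullet> (Q *v v) \<le> c * (v \<bullet> v)"
proof -
  have "0 \<le> v \<bullet> ((c *\<^sub>R mat 1 - Q) *v v)"
    using assms by (auto simp: loewner_le_def psd_def)
  then show ?thesis
    by (simp add: matrix_vector_mult_diff_rdistrib inner_diff_right
        flip: scaleR_matrix_vector_assoc)
qed

text \<open>Symmetry of the Gram matrix. It rewrites quadratic forms in the sketched gradient as
  forms in the matrix products of the moment conditions.\<close>

lemma inner_gram_left: "(gram P *v u) \<bullet> v = u \<bullet> (gram P *v v)"
  unfolding gram_def
  by (metis dot_lmul_matrix matrix_transpose_mul transpose_transpose
      vector_transpose_matrix)

lemma op_norm_pos:
  fixes Q :: "real^'n^'m"
  assumes "Q \<noteq> 0"
  shows "0 < op_norm Q"
proof -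
  have "\<exists>v. Q *v v \<noteq> 0"
    using assms by (metis matrix_eq matrix_vector_mult_0)
  then show ?thesis
    unfolding op_norm_def by (subst onorm_pos_lt) auto
qed

text \<open>Matrix smoothness and expansion of the square bound the new potential by an expression
  linear in the three random matrices with known moments. In the recursion \<open>B\<close> is
  \<open>A (Suc k)\<close> and \<open>\<alpha>\<close> is \<open>a (Suc k)\<close>;
  \<open>weight\<close> makes the squared gradient norm enter with a nonpositive
  coefficient.\<close>

lemma expected_potential_step:
  fixes f :: "real^'d \<Rightarrow> real" and P :: "'b \<Rightarrow> real^'r^'d" and y z :: "real^'d"
  assumes "prob_space M" and moments: "sketch_moments M P LL w l"
    and smooth: "matrix_smooth f LL" and min: "\<And>u. f xstar \<le> f u"
    and "0 < l" and "0 \<le> B" and weight: "w * \<alpha>\<^sup>2 \<le> B / (op_norm LL * l)"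
  defines "d \<equiv> \<lambda>s. gram (P s) *v gradient f y"
  shows "(\<integral>\<^sup>+ s. ennreal (B * (f (y - (1 / (op_norm LL * l)) *\<^sub>R d s) - f xstar)
              + 1/2 * (norm (z - \<alpha> *\<^sub>R d s - xstar))\<^sup>2) \<partial>M)
         \<le> ennreal (B * (f y - f xstar) + 1/2 * (norm (z - xstar))\<^sup>2 - \<alpha> * (gradient f y \<bullet> (z - xstar)))"
    (is "(\<integral>\<^sup>+ s. ennreal (?V s) \<partial>M) \<le> ennreal ?R")
proof -
  interpret prob_space M by fact
  define g where "g = gradient f y"
  define c where "c = 1 / (op_norm LL * l)"
  have "0 < op_norm LL"
    using smooth by (auto simp: matrix_smooth_def intro: op_norm_pos)
  then have c: "0 < c" "c * (l * op_norm LL) = 1"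
    using \<open>0 < l\<close> by (simp_all add: c_def)
  let ?G = "\<lambda>s. gram (P s)"
  have int: "integrable M ?G" "integrable M (\<lambda>s. ?G s ** ?G s)" "integrable M (\<lambda>s. ?G s ** LL ** ?G s)"
    and mean: "(\<integral>s. ?G s \<partial>M) = mat 1"
    and second: "(\<integral>s. ?G s ** ?G s \<partial>M) \<preceq>\<^sub>L w *\<^sub>R mat 1"
    and smoothed: "(\<integral>s. ?G s ** LL ** ?G s \<partial>M) \<preceq>\<^sub>L (l * op_norm LL) *\<^sub>R mat 1"
    using moments by (auto simp: sketch_moments_def)
  note lin = bounded_linear_inner_matrix_vector
  note int_lin[simp] = int[THEN integrable_bounded_linear[OF lin]]
  note integral_lin = int[THEN integral_bounded_linear[OF lin]]
  \<comment> \<open>An integrable majorant of the new potential: each random term is a linear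
    functional of one of the three matrices.\<close>
  define h where "h s = B * (f y - f xstar) + 1/2 * (norm (z - xstar))\<^sup>2
      - B * c * (g \<bullet> (?G s *v g)) + B * c\<^sup>2 / 2 * (g \<bullet> ((?G s ** LL ** ?G s) *v g))
      - \<alpha> * ((z - xstar) \<bullet> (?G s *v g)) + \<alpha>\<^sup>2 / 2 * (g \<bullet> ((?G s ** ?G s) *v g))" for s
  have h_int: "integrable M h"
    unfolding h_def by simp
  have Vh: "?V s \<le> h s" for s
  proof -
    have d: "d s = ?G s *v g"
      by (simp add: d_def g_def)
    have "f (y - c *\<^sub>R d s) \<le> f y + g \<bullet> ((y - c *\<^sub>R d s) - y)
        + 1/2 * (((y - c *\<^sub>R d s) - y) \<bullet> (LL *v ((y - c *\<^sub>R d s) - y)))"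
      using smooth unfolding matrix_smooth_def g_def by blast
    also have "\<dots> = f y - c * (g \<bullet> d s) + c\<^sup>2 / 2 * (d s \<bullet> (LL *v d s))"
      by (simp add: linear_neg[OF matrix_vector_mul_linear] matrix_vector_mult_scaleR
          power2_eq_square)
    also have "d s \<bullet> (LL *v d s) = g \<bullet> ((?G s ** LL ** ?G s) *v g)"
      by (simp add: d inner_gram_left flip: matrix_vector_mul_assoc)
    finally have "B * (f (y - c *\<^sub>R d s) - f xstar)
        \<le> B * (f y - c * (g \<bullet> d s) + c\<^sup>2 / 2 * (g \<bullet> ((?G s ** LL ** ?G s) *v g)) - f xstar)"
      using \<open>0 \<le> B\<close> by (intro mult_left_mono) auto
    moreover have "(norm (z - \<alpha> *\<^sub>R d s - xstar))\<^sup>2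
        = (norm (z - xstar))\<^sup>2 - 2 * \<alpha> * ((z - xstar) \<bullet> d s) + \<alpha>\<^sup>2 * (d s \<bullet> d s)"
      unfolding power2_norm_eq_inner
      by (simp add: inner_commute algebra_simps power2_eq_square)
    moreover have "d s \<bullet> d s = g \<bullet> ((?G s ** ?G s) *v g)"
      by (simp add: d inner_gram_left flip: matrix_vector_mul_assoc)
    ultimately show ?thesis
      unfolding h_def d[symmetric] c_def[symmetric] by (simp add: algebra_simps)
  qed
  have V0: "0 \<le> ?V s" for s
    using \<open>0 \<le> B\<close> min by simp
  have "(\<integral>s. h s \<partial>M) = B * (f y - f xstar) + 1/2 * (norm (z - xstar))\<^sup>2
      - B * c * (g \<bullet> g) + B * c\<^sup>2 / 2 * (g \<bullet> ((\<integral>s. ?G s ** LL ** ?G s \<partial>M) *v g))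
      - \<alpha> * ((z - xstar) \<bullet> g) + \<alpha>\<^sup>2 / 2 * (g \<bullet> ((\<integral>s. ?G s ** ?G s \<partial>M) *v g))"
    unfolding h_def by (simp add: integral_lin mean prob_space)
  also have "\<dots> \<le> B * (f y - f xstar) + 1/2 * (norm (z - xstar))\<^sup>2
      - B * c * (g \<bullet> g) + B * c\<^sup>2 / 2 * (l * op_norm LL * (g \<bullet> g))
      - \<alpha> * ((z - xstar) \<bullet> g) + \<alpha>\<^sup>2 / 2 * (w * (g \<bullet> g))"
    using loewner_le_scaleR_mat_1_D[OF second, of g] loewner_le_scaleR_mat_1_D[OF smoothed, of g] \<open>0 \<le> B\<close>
    by (intro add_mono diff_mono mult_left_mono order_refl) auto
  \<comment> \<open>Since \<open>c * (l * op_norm LL) = 1\<close>, the curvature term gives back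
    exactly half of the descent \<open>B * c * (g \<bullet> g)\<close>.\<close>
  also have "\<dots> = ?R + (w * \<alpha>\<^sup>2 - B * c) / 2 * (g \<bullet> g)"
  proof -
    have "B * c\<^sup>2 / 2 * (l * op_norm LL * (g \<bullet> g)) = B * c * (c * (l * op_norm LL)) / 2 * (g \<bullet> g)"
      by (simp add: power2_eq_square)
    then show ?thesis
      unfolding c(2) by (simp add: g_def inner_commute field_simps)
  qed
  also have "\<dots> \<le> ?R"
  proof -
    have "(w * \<alpha>\<^sup>2 - B * c) / 2 * (g \<bullet> g) \<le> 0"
      using weight by (intro mult_nonpos_nonneg) (simp_all add: c_def)
    then show ?thesis
      by simp
  qed
  finally have hR: "(\<integral>s. h s \<partial>M) \<le> ?R" .
  have "(\<integral>\<^sup>+ s. ennreal (?V s) \<partial>M) \<le> (\<integral>\<^sup>+ s. ennreal (h s) \<partial>M)"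
    by (intro nn_integral_mono ennreal_leI Vh)
  \<comment> \<open>The majorant dominates a nonnegative potential, so it is nonnegative and its two
    integrals agree.\<close>
  also have "\<dots> = ennreal (\<integral>s. h s \<partial>M)"
    by (rule nn_integral_eq_integral[OF h_int]) (use V0 Vh order_trans in blast)
  also have "\<dots> \<le> ennreal ?R"
    using hR by (rule ennreal_leI)
  finally show ?thesis .
qed

section \<open>The accelerated recursion\<close>

text \<open>\<open>a (Suc k)\<close> is the positive root of
  \<open>w * t\<^sup>2 - 2 * m * t - 2 * m * A k = 0\<close>, which gives the quadratic identity.
  For the growth, the induction hypothesis bounds the square root below by \<open>m * k\<close>, so
  increments are at least \<open>m * (k + 1) / w\<close>.\<close>

lemma nag_weights:
  fixes a A :: "nat \<Rightarrow> real"
  assumes "0 < m" and "0 < w" and A0: "A 0 = 0"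
    and a: "\<And>k. a (Suc k) = (m + sqrt (m\<^sup>2 + 2 * w * m * A k)) / w"
    and A: "\<And>k. A (Suc k) = A k + a (Suc k)"
  shows nag_weights_lower: "m * (real k)\<^sup>2 / (2 * w) \<le> A k"
    and nag_weights_pos: "0 < a (Suc k)"
    and nag_weights_quadratic: "w * (a (Suc k))\<^sup>2 = 2 * m * A (Suc k)"
proof -
  show lower: "m * (real k)\<^sup>2 / (2 * w) \<le> A k" for k
  proof (induction k)
    case 0
    then show ?case
      by (simp add: A0)
  next
    case (Suc k)
    have "2 * w * m * (m * (real k)\<^sup>2 / (2 * w)) \<le> 2 * w * m * A k"
      using Suc \<open>0 < m\<close> \<open>0 < w\<close> by (intro mult_left_mono) auto
    then have "(m * real k)\<^sup>2 \<le> m\<^sup>2 + 2 * w * m * A k"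
      using \<open>0 < w\<close> zero_le_power2[of m] by (simp add: power2_eq_square field_simps del: zero_le_square)
    then have "m * real k \<le> sqrt (m\<^sup>2 + 2 * w * m * A k)"
      by (rule real_le_rsqrt)
    then have "(m + m * real k) / w \<le> a (Suc k)"
      unfolding a using \<open>0 < w\<close> by (simp add: divide_right_mono)
    with Suc have "m * (real k)\<^sup>2 / (2 * w) + (m + m * real k) / w \<le> A (Suc k)"
      unfolding A by (rule add_mono)
    \<comment> \<open>The linear increment overshoots the next square by exactly
      \<open>m / (2 * w)\<close>.\<close>
    moreover have "m * (real (Suc k))\<^sup>2 / (2 * w)
        = m * (real k)\<^sup>2 / (2 * w) + (m + m * real k) / w - m / (2 * w)"
      using \<open>0 < w\<close> by (simp add: field_simps power2_eq_square)
    moreover have "0 < m / (2 * w)"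
      using \<open>0 < m\<close> \<open>0 < w\<close> by simp
    ultimately show ?case
      by linarith
  qed
  have "0 \<le> m * (real k)\<^sup>2 / (2 * w)"
    using \<open>0 < m\<close> \<open>0 < w\<close> by simp
  then have Ak: "0 \<le> A k"
    using lower[of k] by linarith
  then have rad: "0 \<le> m\<^sup>2 + 2 * w * m * A k"
    using \<open>0 < m\<close> \<open>0 < w\<close> by simp
  then show "0 < a (Suc k)"
    unfolding a using \<open>0 < m\<close> \<open>0 < w\<close> by (intro divide_pos_pos add_pos_nonneg) auto
  define q where "q = sqrt (m\<^sup>2 + 2 * w * m * A k)"
  have "q\<^sup>2 = m\<^sup>2 + 2 * w * m * A k"
    using rad by (simp add: q_def)
  moreover have "w * a (Suc k) = m + q"
    using \<open>0 < w\<close> by (simp add: a q_def)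
  \<comment> \<open>The extra factor \<open>w\<close> keeps the identity polynomial in
    \<open>w * a (Suc k)\<close>; it is cancelled afterwards.\<close>
  ultimately have "w * (w * (a (Suc k))\<^sup>2) = w * (2 * m * A (Suc k))"
    unfolding A by algebra
  then show "w * (a (Suc k))\<^sup>2 = 2 * m * A (Suc k)"
    using \<open>0 < w\<close> by simp
qed

text \<open>The gradient inequalities at \<open>y\<close> towards \<open>x\<close> and towards
  \<open>u\<close>, with weights \<open>A\<close> and \<open>\<alpha>\<close>, are added; the choice
  of \<open>y\<close> cancels \<open>x\<close> and \<open>y\<close> in the linear terms and leaves
  \<open>z - u\<close>.\<close>

lemma nag_coupling:
  fixes f :: "'v::real_inner \<Rightarrow> real"
  assumes convex: "convex_on UNIV f" and g: "GDERIV f y :> g" and "0 \<le> A"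
    and "0 \<le> \<alpha>" and y: "(A + \<alpha>) *\<^sub>R y = A *\<^sub>R x + \<alpha> *\<^sub>R z"
  shows "(A + \<alpha>) * (f y - f u) - \<alpha> * (g \<bullet> (z - u)) \<le> A * (f x - f u)"
proof -
  have "A * (f y + g \<bullet> (x - y)) \<le> A * f x" "\<alpha> * (f y + g \<bullet> (u - y)) \<le> \<alpha> * f u"
    using \<open>0 \<le> A\<close> \<open>0 \<le> \<alpha>\<close> by (auto intro!: mult_left_mono convex_on_above_gradient[OF convex g])
  moreover have "(A + \<alpha>) * (g \<bullet> y) = A * (g \<bullet> x) + \<alpha> * (g \<bullet> z)"
    using arg_cong[OF y, of "inner g"] by (simp add: inner_add_right)
  ultimately show ?thesis
    by (simp add: algebra_simps)
qed

text \<open>Only the pair of \<open>x\<close> and \<open>z\<close> is kept as state. The point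
  \<open>y\<close> is recomputed from it, so the recursion depends on the past through this pair
  alone.\<close>

definition nag_step ::
    "(real^'d \<Rightarrow> real) \<Rightarrow> real \<Rightarrow> (nat \<Rightarrow> real) \<Rightarrow> (nat \<Rightarrow> real) \<Rightarrow> nat \<Rightarrow>
     (real^'d) \<times> (real^'d) \<Rightarrow> real^'r^'d \<Rightarrow> (real^'d) \<times> (real^'d)" where
  "nag_step f c a A k v P =
     (let y = (A k / A (Suc k)) *\<^sub>R fst v + (a (Suc k) / A (Suc k)) *\<^sub>R snd v;
          d = gram P *v gradient f y
      in (y - c *\<^sub>R d, snd v - a (Suc k) *\<^sub>R d))"

definition nag_potential ::
    "('v::real_normed_vector \<Rightarrow> real) \<Rightarrow> 'v \<Rightarrow> (nat \<Rightarrow> real) \<Rightarrow> nat \<Rightarrow> 'v \<times> 'v \<Rightarrow> real" where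
  "nag_potential f u A k v = A k * (f (fst v) - f u) + 1/2 * (norm (snd v - u))\<^sup>2"

text \<open>The gradient is merely measurable, so it is composed with the map applying the Gram
  matrix to a vector, which is jointly continuous because it is polynomial in the entries.\<close>

lemma measurable_nag_step:
  fixes f :: "real^'d \<Rightarrow> real"
  assumes "\<And>x. f differentiable (at x)"
  shows "case_prod (nag_step f c a A k :: _ \<Rightarrow> real^'r^'d \<Rightarrow> _)
    \<in> borel_measurable (borel \<Otimes>\<^sub>M borel)"
proof -
  have [measurable]: "gradient f \<in> borel_measurable borel"
    using assms by (rule borel_measurable_gradient)
  have "continuous_on UNIV (\<lambda>q :: (real^'r^'d) \<times> (real^'d). gram (fst q) *v snd q)"
    unfolding gram_def matrix_matrix_mult_def matrix_vector_mult_def transpose_def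
    by (simp, intro continuous_intros)
  then have gram: "(\<lambda>q :: (real^'r^'d) \<times> (real^'d). gram (fst q) *v snd q)
      \<in> borel_measurable (borel \<Otimes>\<^sub>M borel)"
    unfolding borel_prod by (rule borel_measurable_continuous_onI)
  have [measurable]: "fst \<in> borel_measurable (borel :: ((real^'d) \<times> (real^'d)) measure)"
    "snd \<in> borel_measurable (borel :: ((real^'d) \<times> (real^'d)) measure)"
    unfolding borel_prod[symmetric] by measurable
  define y :: "((real^'d) \<times> (real^'d)) \<times> (real^'r^'d) \<Rightarrow> real^'d" where
    "y q = (A k / A (Suc k)) *\<^sub>R fst (fst q) + (a (Suc k) / A (Suc k)) *\<^sub>R snd (fst q)" for q
  have [measurable]: "y \<in> borel_measurable (borel \<Otimes>\<^sub>M borel)"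
    unfolding y_def by measurable
  have [measurable]: "(\<lambda>q. gram (snd q) *v gradient f (y q)) \<in> borel_measurable (borel \<Otimes>\<^sub>M borel)"
  proof -
    have "(\<lambda>q. (snd q, gradient f (y q))) \<in> measurable (borel \<Otimes>\<^sub>M borel) (borel \<Otimes>\<^sub>M borel)"
      by measurable
    from measurable_compose[OF this gram] show ?thesis
      by simp
  qed
  show ?thesis
    unfolding nag_step_def case_prod_unfold Let_def y_def[symmetric]
    by (rule borel_measurable_Pair) measurable
qed

text \<open>The expected descent at \<open>y\<close>, followed by the convexity coupling that
  returns from \<open>y\<close> to the old pair. It supplies the one-step hypothesis for the random
  recursion.\<close>

lemma nn_integral_nag_step_le:
  fixes f :: "real^'d \<Rightarrow> real" and P :: "'b \<Rightarrow> real^'r^'d"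
  assumes "prob_space M" and "sketch_moments M P LL w l" and "matrix_smooth f LL"
    and diff: "\<And>x. f differentiable (at x)" and convex: "convex_on UNIV f"
    and min: "\<And>u. f xstar \<le> f u" and "0 < l"
    and Ak: "0 \<le> A k" and a: "0 < a (Suc k)" and A: "A (Suc k) = A k + a (Suc k)"
    and weight: "w * (a (Suc k))\<^sup>2 = A (Suc k) / (op_norm LL * l)"
  shows "(\<integral>\<^sup>+ s. ennreal (nag_potential f xstar A (Suc k)
            (nag_step f (1 / (op_norm LL * l)) a A k v (P s))) \<partial>M)
         \<le> ennreal (nag_potential f xstar A k v)"
proof -
  define y where "y = (A k / A (Suc k)) *\<^sub>R fst v + (a (Suc k) / A (Suc k)) *\<^sub>R snd v"
  have pos: "0 < A (Suc k)"
    using Ak a A by simp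
  then have "(A k + a (Suc k)) *\<^sub>R y = A k *\<^sub>R fst v + a (Suc k) *\<^sub>R snd v"
    by (simp add: y_def scaleR_add_right flip: A)
  then have "(A k + a (Suc k)) * (f y - f xstar) - a (Suc k) * (gradient f y \<bullet> (snd v - xstar))
      \<le> A k * (f (fst v) - f xstar)"
    using Ak a by (intro nag_coupling[OF convex GDERIV_gradient[OF diff]]) auto
  then have "A (Suc k) * (f y - f xstar) + 1/2 * (norm (snd v - xstar))\<^sup>2
      - a (Suc k) * (gradient f y \<bullet> (snd v - xstar)) \<le> nag_potential f xstar A k v"
    by (simp add: nag_potential_def A)
  from order_trans[OF expected_potential_step[OF assms(1-3) min \<open>0 < l\<close> less_imp_le[OF pos],
        of "a (Suc k)" y "snd v"] ennreal_leI[OF this]]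
  show ?thesis
    using weight by (simp add: nag_potential_def nag_step_def Let_def flip: y_def)
qed

theorem theorem3p3:
  fixes f :: "real^'d \<Rightarrow> real"
    and LL :: "real^'d^'d"
    and w l L R0 :: real
    and M0 :: "'b measure" and P :: "'b \<Rightarrow> real^'r^'d"
    and M :: "'a measure" and Ps :: "nat \<Rightarrow> 'a \<Rightarrow> real^'r^'d"
    and x0 xstar :: "real^'d"
    and a A :: "nat \<Rightarrow> real"
    and x y z :: "nat \<Rightarrow> 'a \<Rightarrow> real^'d"
  assumes "2 \<le> CARD('d)" and "1 \<le> CARD('r)" and "CARD('r) \<le> CARD('d)"
    and "\<forall>u. f differentiable (at u)"
    and "convex_on UNIV f"
    and "\<forall>u. f xstar \<le> f u"
    and "matrix_smooth f LL"
    and "L = op_norm LL"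
    and "w > 0" and "l > 0"
    and "prob_space M0" and "P \<in> borel_measurable M0"
    and "sketch_moments M0 P LL w l"
    and "prob_space M"
    and "iid_copies M Ps M0 P"
    and "\<forall>s\<in>space M. rs_nag_c_run f L w l x0 (\<lambda>k. Ps k s) a A (\<lambda>k. x k s) (\<lambda>k. y k s) (\<lambda>k. z k s)"
    and "R0 = norm (x0 - xstar)"
  shows "(\<forall>N\<ge>1. integrable M (\<lambda>s. f (x N s) - f xstar) \<and>
            (\<integral>s. f (x N s) - f xstar \<partial>M) \<le> 2 * L * w * l * ((norm (x0 - xstar))\<^sup>2 / (real N)\<^sup>2))
       \<and> 0 < complexity_const
       \<and> (\<forall>\<epsilon>>0. \<forall>N\<ge>1. real N \<ge> complexity_const * R0 * sqrt (L * w * l / \<epsilon>) \<longrightarrow>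
            (\<integral>s. f (x N s) - f xstar \<partial>M) \<le> \<epsilon>)
       \<and> (\<forall>\<epsilon>>0. \<forall>N\<ge>1. real (oracle_calls CARD('r) N)
              \<ge> complexity_const * R0 * sqrt (L * w * l * (real CARD('r))\<^sup>2 / \<epsilon>) \<longrightarrow>
            (\<integral>s. f (x N s) - f xstar \<partial>M) \<le> \<epsilon>)"
proof -
  note diff = assms(4)[rule_format] and convex = assms(5) and min = assms(6)[rule_format]
    and smooth = assms(7) and L = assms(8) and w = assms(9) and l = assms(10)
    and moments = assms(13) and run = assms(16) and R0 = assms(17)
  interpret prob_space M by fact
  have Lpos: "0 < L"
    using smooth unfolding L by (auto simp: matrix_smooth_def intro: op_norm_pos)
  define c where "c = 1 / (L * l)"
  define m where "m = 1 / (2 * L * l)"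
  have m: "0 < m"
    using Lpos l by (simp add: m_def)
  note run' = run[THEN bspec, unfolded rs_nag_c_run_def Let_def, folded m_def c_def]
  \<comment> \<open>The weights are deterministic, so their recursion can be read off at any single
    sample point.\<close>
  obtain s0 where s0: "s0 \<in> space M"
    using not_empty by blast
  have A0: "A 0 = 0" and a: "a (Suc k) = (m + sqrt (m\<^sup>2 + 2 * w * m * A k)) / w"
    and A: "A (Suc k) = A k + a (Suc k)" for k
    using run'[OF s0] by auto
  note lower = nag_weights_lower[where a = a and A = A, OF m w A0 a A]
    and a_pos = nag_weights_pos[where a = a and A = A, OF m w A0 a A]
    and quadratic = nag_weights_quadratic[where a = a and A = A, OF m w A0 a A]
  have A_nonneg: "0 \<le> A k" for k
    by (rule order_trans[OF _ lower]) (use m w in simp)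
  \<comment> \<open>This is the quadratic identity with \<open>2 * m = 1 / (L * l)\<close>.\<close>
  have weight: "w * (a (Suc k))\<^sup>2 = A (Suc k) / (op_norm LL * l)" for k
    using quadratic[of k] by (simp add: m_def L)
  have law: "distr M borel (Ps k) = distr M0 borel P" and indep: "indep_vars (\<lambda>_. borel) Ps UNIV" for k
    using assms(15) by (auto simp: iid_copies_def)
  let ?V = "\<lambda>k v. ennreal (nag_potential f xstar A k v)"
  have f_meas[measurable]: "f \<in> borel_measurable borel"
    by (intro borel_measurable_continuous_onI continuous_at_imp_continuous_on ballI
        differentiable_imp_continuous_within diff)
  have [measurable]: "fst \<in> borel_measurable (borel :: ((real^'d) \<times> (real^'d)) measure)"
    "snd \<in> borel_measurable (borel :: ((real^'d) \<times> (real^'d)) measure)"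
    unfolding borel_prod[symmetric] by measurable
  have V_meas: "?V k \<in> borel_measurable borel" for k
    unfolding nag_potential_def by measurable
  have F_meas: "case_prod (nag_step f c a A k :: _ \<Rightarrow> real^'r^'d \<Rightarrow> _)
      \<in> measurable (borel \<Otimes>\<^sub>M borel) borel" for k
    by (rule measurable_nag_step[OF diff])
  have X0: "(x 0 s, z 0 s) = (x0, x0)" if "s \<in> space M" for s
    using run'[OF that] by simp
  have XSuc: "(x (Suc k) s, z (Suc k) s) = nag_step f c a A k (x k s, z k s) (Ps k s)"
    if "s \<in> space M" for k s
  proof -
    have y: "y k s = (A k / A (Suc k)) *\<^sub>R x k s + (a (Suc k) / A (Suc k)) *\<^sub>R z k s"
      and x: "x (Suc k) s = y k s - c *\<^sub>R (Ps k s *v (transpose (Ps k s) *v gradient f (y k s)))"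
      and z: "z (Suc k) s = z k s - a (Suc k) *\<^sub>R (Ps k s *v (transpose (Ps k s) *v gradient f (y k s)))"
      using run'[OF that] by blast+
    show ?thesis
      unfolding x z nag_step_def Let_def gram_def fst_conv snd_conv y[symmetric]
      by (simp only: matrix_vector_mul_assoc)
  qed
  have step: "(\<integral>\<^sup>+ p. ?V (Suc k) (nag_step f c a A k v p) \<partial>distr M0 borel P) \<le> ?V k v" for k v
  proof -
    have "(\<lambda>p :: real^'r^'d. ?V (Suc k) (nag_step f c a A k v p)) \<in> borel_measurable borel"
    proof -
      have "Pair v \<in> measurable borel (borel \<Otimes>\<^sub>M (borel :: (real^'r^'d) measure))"
        by (rule measurable_Pair1') simp
      from measurable_compose[OF measurable_compose[OF this F_meas] V_meas] show ?thesis
        by simp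
    qed
    \<comment> \<open>The moments are stated for \<open>P\<close> on \<open>M0\<close>, so the
      integral over the common law is moved there.\<close>
    then have "(\<integral>\<^sup>+ p. ?V (Suc k) (nag_step f c a A k v p) \<partial>distr M0 borel P)
        = (\<integral>\<^sup>+ s. ?V (Suc k) (nag_step f c a A k v (P s)) \<partial>M0)"
      by (intro nn_integral_distr[OF assms(12)]) simp
    also have "\<dots> \<le> ?V k v"
      unfolding c_def L
      by (rule nn_integral_nag_step_le[where a = a and A = A and k = k,
            OF assms(11) moments smooth diff convex min l A_nonneg a_pos A weight])
    finally show ?thesis .
  qed
  note orbit = nn_integral_orbit_le[where X = "\<lambda>k s. (x k s, z k s)" and V = ?V and \<xi> = Ps
        and F = "nag_step f c a A" and u = "(x0, x0)" and \<mu> = "distr M0 borel P"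
        and E = borel and S = borel,
      OF indep law F_meas _ V_meas X0 XSuc step]
  have rate: "integrable M (\<lambda>s. f (x N s) - f xstar)
      \<and> (\<integral>s. f (x N s) - f xstar \<partial>M) \<le> 2 * L * w * l * (R0\<^sup>2 / (real N)\<^sup>2)" if "1 \<le> N" for N
  proof -
    have "x N \<in> borel_measurable M"
      using measurable_compose[OF orbit(1)[of N], of fst borel] by simp
    then have meas: "(\<lambda>s. f (x N s) - f xstar) \<in> borel_measurable M"
      by measurable
    have lower_pos: "0 < m * (real N)\<^sup>2 / (2 * w)"
      using m w \<open>1 \<le> N\<close> by simp
    have AN: "0 < A N"
      using lower_pos lower[of N] by (rule less_le_trans)
    have "ennreal (A N) * (\<integral>\<^sup>+ s. ennreal (f (x N s) - f xstar) \<partial>M)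
        = (\<integral>\<^sup>+ s. ennreal (A N * (f (x N s) - f xstar)) \<partial>M)"
      using AN meas min by (simp add: ennreal_mult flip: nn_integral_cmult)
    also have "\<dots> \<le> (\<integral>\<^sup>+ s. ?V N (x N s, z N s) \<partial>M)"
      by (intro nn_integral_mono ennreal_leI) (simp add: nag_potential_def)
    \<comment> \<open>As \<open>A 0 = 0\<close>, the initial potential contains no function value,
      only half the squared distance.\<close>
    also have "\<dots> \<le> ennreal (R0\<^sup>2 / 2)"
      using orbit(2)[of N] by (simp add: nag_potential_def A0 R0)
    finally have bound: "ennreal (A N) * (\<integral>\<^sup>+ s. ennreal (f (x N s) - f xstar) \<partial>M) \<le> ennreal (R0\<^sup>2 / 2)" .
    \<comment> \<open>Integrability is a consequence of the bound: \<open>A N\<close> is positive,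
      so an infinite integral would make the left side infinite.\<close>
    have "(\<integral>\<^sup>+ s. ennreal (f (x N s) - f xstar) \<partial>M) < top"
    proof (rule ccontr)
      assume "\<not> ?thesis"
      then have "(\<integral>\<^sup>+ s. ennreal (f (x N s) - f xstar) \<partial>M) = top"
        by (simp add: top.not_eq_extremum[symmetric])
      with bound AN show False
        by (simp add: ennreal_mult_top top_unique)
    qed
    then have int: "integrable M (\<lambda>s. f (x N s) - f xstar)"
      using meas min by (intro integrableI_nonneg) auto
    have "ennreal (A N * (\<integral>s. f (x N s) - f xstar \<partial>M)) \<le> ennreal (R0\<^sup>2 / 2)"
      using bound AN nn_integral_eq_integral[OF int] min by (simp add: ennreal_mult)
    then have AR: "A N * (\<integral>s. f (x N s) - f xstar \<partial>M) \<le> R0\<^sup>2 / 2"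
      by simp
    \<comment> \<open>Nonnegativity of the expected gap allows \<open>A N\<close> to be replaced by
      its lower bound.\<close>
    have "m * (real N)\<^sup>2 / (2 * w) * (\<integral>s. f (x N s) - f xstar \<partial>M)
        \<le> A N * (\<integral>s. f (x N s) - f xstar \<partial>M)"
      using lower[of N] min by (intro mult_right_mono integral_nonneg_AE) auto
    also note AR
    finally have "(\<integral>s. f (x N s) - f xstar \<partial>M) \<le> (R0\<^sup>2 / 2) / (m * (real N)\<^sup>2 / (2 * w))"
      using lower_pos by (simp only: pos_le_divide_eq mult.commute)
    also have "\<dots> = 2 * L * w * l * (R0\<^sup>2 / (real N)\<^sup>2)"
      using Lpos l w \<open>1 \<le> N\<close> by (simp add: m_def field_simps)
    finally show ?thesis
      using int by blast
  qed
  have iterations: "(\<integral>s. f (x N s) - f xstar \<partial>M) \<le> \<epsilon>"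
    if \<epsilon>: "0 < \<epsilon>" and N: "1 \<le> N" "complexity_const * R0 * sqrt (L * w * l / \<epsilon>) \<le> real N" for \<epsilon> N
  proof -
    \<comment> \<open>Nonnegativity permits squaring the hypothesis on \<open>N\<close>; the square
      of \<open>sqrt 2\<close> is the factor 2 of the rate.\<close>
    have "0 \<le> complexity_const * R0 * sqrt (L * w * l / \<epsilon>)"
      using Lpos w l \<epsilon> by (simp add: complexity_const_def R0)
    from power_mono[OF N(2) this, of 2]
    have "2 * R0\<^sup>2 * (L * w * l / \<epsilon>) \<le> (real N)\<^sup>2"
      using Lpos w l \<epsilon> by (simp add: complexity_const_def power_mult_distrib)
    then have "2 * L * w * l * (R0\<^sup>2 / (real N)\<^sup>2) \<le> \<epsilon>"
      using \<epsilon> N(1) by (simp add: field_simps)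
    with rate[OF N(1)] show ?thesis
      by linarith
  qed
  have calls: "complexity_const * R0 * sqrt (L * w * l / \<epsilon>) \<le> real N"
    if "real (oracle_calls CARD('r) N)
      \<ge> complexity_const * R0 * sqrt (L * w * l * (real CARD('r))\<^sup>2 / \<epsilon>)" for \<epsilon> N
  proof -
    \<comment> \<open>The factor \<open>CARD('r)\<close> leaves the root and cancels against the
      cost per iteration, which reduces the oracle bound to the iteration bound.\<close>
    have "sqrt (L * w * l * (real CARD('r))\<^sup>2 / \<epsilon>) = real CARD('r) * sqrt (L * w * l / \<epsilon>)"
      by (simp add: real_sqrt_mult real_sqrt_divide)
    with that have "real CARD('r) * (complexity_const * R0 * sqrt (L * w * l / \<epsilon>)) \<le> real CARD('r) * real N"
      by (simp add: oracle_calls_def mult_ac)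
    then show ?thesis
      by (simp add: mult_le_cancel_left_pos)
  qed
  show ?thesis
    using rate iterations calls by (auto simp: complexity_const_def R0)
qed

end
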